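(* Let $\beta>0$, $0<c<1$, $t>\ln(c)$ and $n\in\mathbb{N}$. Then for all $x$, $$M_n(x;\beta,ce^{-t})=\sum_{k=0}^n\frac{(-n)_k(\beta+x)_k}{k!\,(\beta)_k}\,M_{n-k}(x;\beta+k,c)\,e^{nt}(1-e^{-t})^k.$$
   Context: $\mathbb N=\{0,1,2,\dots\}$, $(y)_k=y(y+1)\cdots(y+k-1)$. The Meixner polynomials are $$M_n(x;\beta,c)=\sum_{j=0}^n\frac{(-n)_j(-x)_j}{(\beta)_j\,j!}\left(\frac{c-1}{c}\right)^j,$$ polynomials of degree $n$ in $x$. *)

theory Defs
  imports Complex_Main
begin

text \<open>The rising factorial \<open>(y)\<^sub>k\<close> is the library's \<^const>\<open>pochhammer\<close>.\<close>

definition meixner :: "nat \<Rightarrow> 'a::field_char_0 \<Rightarrow> 'a \<Rightarrow> 'a \<Rightarrow> 'a" where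
  "meixner n x \<beta> c =
     (\<Sum>j=0..n. pochhammer (- of_nat n) j * pochhammer (- x) j / (pochhammer \<beta> j * fact j)
        * ((c - 1) / c) ^ j)"

end

theory Submission
  imports Defs
begin

text \<open>Write \<open>a = 1 / c\<close>. Up to the factor \<open>(\<beta>)\<^sub>n / n!\<close>, the Meixner polynomial is the coefficient of
  \<open>s\<^sup>n\<close> in \<open>(1 - a s)\<^sup>x (1 - s)\<^bsup>-x-\<beta>\<^esup>\<close>. Comparing coefficients turns this into the finite identity
  \<open>meixner_convolution\<close>, a consequence of the Vandermonde convolution.

  In that form \<open>c\<close> occurs only through the powers \<open>a\<^sup>i\<close>, while \<open>\<beta>\<close> occurs only through
  \<open>(x + \<beta>)\<^bsub>n-i\<^esub>\<close>. Replacing \<open>c\<close> by \<open>c / T\<close>, where \<open>T = e\<^sup>t\<close>, multiplies the \<open>i\<close>-th term by \<open>T\<^sup>i\<close>.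
  On the other side of the claim, the factor \<open>(x + \<beta>)\<^sub>k\<close> and the shifted factor
  \<open>(x + \<beta> + k)\<^bsub>n-k-i\<^esub>\<close> combine to \<open>(x + \<beta>)\<^bsub>n-i\<^esub>\<close>, which is independent of \<open>k\<close>. The sum over \<open>k\<close> that is
  left is the binomial expansion of \<open>((1 - T) + T)\<^bsup>n-i\<^esup> = 1\<close>, which gives the
  theorem in any field of characteristic zero where \<open>c\<close>, \<open>T\<close> and \<open>(\<beta>)\<^sub>n\<close> do not vanish.\<close>

lemma sum_triangle_swap:
  fixes g :: "nat \<Rightarrow> nat \<Rightarrow> 'a::comm_monoid_add"
  shows "(\<Sum>j\<le>n. \<Sum>i\<le>j. g i (j - i)) = (\<Sum>i\<le>n. \<Sum>l\<le>n - i. g i l)"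
proof -
  have "(\<Sum>j\<le>n. \<Sum>i\<le>j. g i (j - i)) = (\<Sum>(i, l)\<in>{(i, l). i + l \<le> n}. g i l)"
    by (rule sum.triangle_reindex_eq[symmetric])
  also have "{(i, l). i + l \<le> n} = (SIGMA i:{..n}. {..n - i})"
    by auto
  also have "(\<Sum>(i, l)\<in>\<dots>. g i l) = (\<Sum>i\<le>n. \<Sum>l\<le>n - i. g i l)"
    by (rule sum.Sigma[symmetric]) auto
  finally show ?thesis .
qed

text \<open>Reflecting \<open>(b + l)\<^bsub>m-l\<^esub>\<close> to \<open>(-1)\<^bsup>m-l\<^esup> (1 - b - m)\<^bsub>m-l\<^esub>\<close> makes both the
  sign and the base point independent of \<open>l\<close>, so this is the Vandermonde convolution for \<open>y\<close> and \<open>1 - b - m\<close>.\<close>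

lemma pochhammer_diff_binomial_sum:
  fixes b y :: "'a::comm_ring_1"
  shows "(\<Sum>l\<le>m. (-1) ^ l * of_nat (m choose l) * pochhammer y l * pochhammer (b + of_nat l) (m - l))
    = pochhammer (b - y) m"
proof -
  have reflect: "pochhammer (b + of_nat l) (m - l) = (-1) ^ (m - l) * pochhammer (1 - b - of_nat m) (m - l)"
    if "l \<le> m" for l
    using that pochhammer_minus[of "b + of_nat m - 1" "m - l"]
    by (simp add: of_nat_diff algebra_simps flip: power_mult_distrib mult.assoc)
  have "(\<Sum>l\<le>m. (-1) ^ l * of_nat (m choose l) * pochhammer y l * pochhammer (b + of_nat l) (m - l))
      = (-1) ^ m * (\<Sum>l\<le>m. of_nat (m choose l) * pochhammer y l * pochhammer (1 - b - of_nat m) (m - l))"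
    unfolding sum_distrib_left
  proof (rule sum.cong[OF refl])
    fix l assume "l \<in> {..m}"
    then have l: "l \<le> m" by simp
    then have "(-1 :: 'a) ^ m = (-1) ^ l * (-1) ^ (m - l)"
      by (simp flip: power_add)
    then show "(-1) ^ l * of_nat (m choose l) * pochhammer y l * pochhammer (b + of_nat l) (m - l)
      = (-1) ^ m * (of_nat (m choose l) * pochhammer y l * pochhammer (1 - b - of_nat m) (m - l))"
      by (simp add: reflect[OF l] mult_ac)
  qed
  also have "\<dots> = (-1) ^ m * pochhammer (- (b - y + of_nat m - 1)) m"
    using pochhammer_binomial_sum[of y "1 - b - of_nat m" m] by (simp add: algebra_simps)
  also have "\<dots> = pochhammer (b - y) m"
    unfolding pochhammer_minus by (simp flip: power_mult_distrib mult.assoc)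
  finally show ?thesis .
qed

lemma pochhammer_neg_of_nat:
  assumes "k \<le> n"
  shows "pochhammer (- of_nat n :: 'a::field_char_0) k = (-1) ^ k * fact n / fact (n - k)"
proof -
  have "pochhammer (of_nat n - of_nat k + 1 :: 'a) k * fact (n - k) = fact n"
    using assms pochhammer_product'[of "1 :: 'a" "n - k" k]
    by (simp add: pochhammer_fact of_nat_diff algebra_simps)
  then show ?thesis
    by (simp add: pochhammer_minus eq_divide_eq mult.assoc)
qed

text \<open>The coefficient of \<open>s\<^sup>n\<close> in the product of the binomial series of \<open>(1 - s / c)\<^sup>x\<close> and
  \<open>(1 - s)\<^bsup>-x-\<beta>\<^esup>\<close>. It is obtained by expanding \<open>((c - 1) / c)\<^sup>j = (1 - 1 / c)\<^sup>j\<close> in the definition and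
  collecting the powers of \<open>1 / c\<close>.\<close>

lemma meixner_convolution:
  fixes x \<beta> c :: "'a::field_char_0"
  assumes "c \<noteq> 0" and nz: "pochhammer \<beta> n \<noteq> 0"
  shows "pochhammer \<beta> n / fact n * meixner n x \<beta> c
    = (\<Sum>i\<le>n. pochhammer (- x) i / fact i * (1 / c) ^ i * (pochhammer (x + \<beta>) (n - i) / fact (n - i)))"
proof -
  define g where "g i l = pochhammer (- x) (i + l) * pochhammer (\<beta> + of_nat (i + l)) (n - (i + l))
      / (fact (n - (i + l)) * fact i * fact l) * (-1) ^ l * (1 / c) ^ i" for i l
  have term_expand: "pochhammer \<beta> n / fact n * (pochhammer (- of_nat n) j * pochhammer (- x) j
      / (pochhammer \<beta> j * fact j) * ((c - 1) / c) ^ j) = (\<Sum>i\<le>j. g i (j - i))" (is "?L = _")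
    if "j \<le> n" for j
  proof -
    have split: "pochhammer \<beta> n = pochhammer \<beta> j * pochhammer (\<beta> + of_nat j) (n - j)"
      using that by (rule pochhammer_product)
    with nz have "pochhammer \<beta> j \<noteq> 0" by auto
    moreover have "((c - 1) / c) ^ j = (-1) ^ j * (1 / c + (-1)) ^ j"
      using \<open>c \<noteq> 0\<close> by (simp add: diff_divide_distrib flip: power_mult_distrib)
    ultimately have "?L = pochhammer (- x) j * pochhammer (\<beta> + of_nat j) (n - j)
        / (fact (n - j) * fact j) * (1 / c + (-1)) ^ j"
      by (simp add: split pochhammer_neg_of_nat[OF that] field_simps flip: power_mult_distrib)
    also have "\<dots> = (\<Sum>i\<le>j. pochhammer (- x) j * pochhammer (\<beta> + of_nat j) (n - j)
        / (fact (n - j) * fact j) * (of_nat (j choose i) * (1 / c) ^ i * (-1) ^ (j - i)))"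
      unfolding binomial_ring sum_distrib_left ..
    also have "\<dots> = (\<Sum>i\<le>j. g i (j - i))"
      by (rule sum.cong) (auto simp: g_def binomial_fact mult_ac)
    finally show ?thesis .
  qed
  have collect: "(\<Sum>l\<le>n - i. g i l)
      = pochhammer (- x) i / fact i * (1 / c) ^ i * (pochhammer (x + \<beta>) (n - i) / fact (n - i))"
    if "i \<le> n" for i
  proof -
    have "g i l = pochhammer (- x) i / fact i * (1 / c) ^ i / fact (n - i)
        * ((-1) ^ l * of_nat (n - i choose l) * pochhammer (- x + of_nat i) l
          * pochhammer (\<beta> + of_nat i + of_nat l) (n - i - l))" if "l \<le> n - i" for l
      using that by (simp add: g_def pochhammer_product' binomial_fact add.assoc mult_ac)
    then have "(\<Sum>l\<le>n - i. g i l) = pochhammer (- x) i / fact i * (1 / c) ^ i / fact (n - i)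
        * pochhammer (\<beta> + of_nat i - (- x + of_nat i)) (n - i)"
      unfolding pochhammer_diff_binomial_sum[symmetric, of "\<beta> + of_nat i"] sum_distrib_left
      by (intro sum.cong) auto
    then show ?thesis
      by (simp add: add.commute)
  qed
  have "pochhammer \<beta> n / fact n * meixner n x \<beta> c = (\<Sum>j\<le>n. \<Sum>i\<le>j. g i (j - i))"
    unfolding meixner_def sum_distrib_left atLeast0AtMost
    by (intro sum.cong refl term_expand) simp
  also have "\<dots> = (\<Sum>i\<le>n. \<Sum>l\<le>n - i. g i l)"
    by (rule sum_triangle_swap)
  also have "\<dots> = (\<Sum>i\<le>n. pochhammer (- x) i / fact i * (1 / c) ^ i
      * (pochhammer (x + \<beta>) (n - i) / fact (n - i)))"
    by (rule sum.cong) (auto simp: collect)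
  finally show ?thesis .
qed

text \<open>After \<open>meixner_convolution\<close>, interchanging the sums over \<open>k\<close> and \<open>i\<close> leaves
  \<open>((1 - T) + T)\<^bsup>n-i\<^esup>\<close> as the inner sum, since \<open>T\<^sup>n (1 - 1 / T)\<^sup>k = T\<^bsup>n-k\<^esup> (T - 1)\<^sup>k\<close>.\<close>

lemma meixner_scale:
  fixes x \<beta> c T :: "'a::field_char_0"
  assumes "c \<noteq> 0" and "T \<noteq> 0" and nz: "pochhammer \<beta> n \<noteq> 0"
  shows "meixner n x \<beta> (c / T) = (\<Sum>k\<le>n. pochhammer (- of_nat n) k * pochhammer (\<beta> + x) k
      / (fact k * pochhammer \<beta> k) * meixner (n - k) x (\<beta> + of_nat k) c * T ^ n * (1 - 1 / T) ^ k)"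
    (is "_ = (\<Sum>k\<le>n. ?R k)")
proof -
  define h where "h k i = pochhammer (- x) i / fact i * (1 / c) ^ i * T ^ i
      * pochhammer (x + \<beta>) (n - i) / (fact k * fact (n - i - k)) * (1 - T) ^ k * T ^ (n - i - k)"
    for k i
  have term_expand: "pochhammer \<beta> n / fact n * ?R k = (\<Sum>i\<le>n - k. h k i)" if k: "k \<le> n" for k
  proof -
    let ?M = "meixner (n - k) x (\<beta> + of_nat k) c"
    have split: "pochhammer \<beta> n = pochhammer \<beta> k * pochhammer (\<beta> + of_nat k) (n - k)"
      using k by (rule pochhammer_product)
    with nz have nz': "pochhammer \<beta> k \<noteq> 0" "pochhammer (\<beta> + of_nat k) (n - k) \<noteq> 0"
      by auto
    have "T ^ n * (1 - 1 / T) ^ k = T ^ (n - k) * (T * (1 - 1 / T)) ^ k"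
      using k by (simp add: power_mult_distrib flip: power_add mult.assoc)
    also have "T * (1 - 1 / T) = - 1 * (1 - T)"
      using \<open>T \<noteq> 0\<close> by (simp add: algebra_simps)
    finally have pw: "T ^ n * (1 - 1 / T) ^ k = (-1) ^ k * (1 - T) ^ k * T ^ (n - k)"
      by (simp only: power_mult_distrib mult_ac)
    have "pochhammer \<beta> n / fact n * ?R k
        = pochhammer \<beta> n / fact n * (pochhammer (- of_nat n) k * pochhammer (\<beta> + x) k
          / (fact k * pochhammer \<beta> k) * ?M) * (T ^ n * (1 - 1 / T) ^ k)"
      by (simp only: mult.assoc)
    also have "\<dots> = pochhammer (\<beta> + x) k / fact k * (1 - T) ^ k * T ^ (n - k)
        * (pochhammer (\<beta> + of_nat k) (n - k) / fact (n - k) * ?M)"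
      unfolding pw pochhammer_neg_of_nat[OF k] split using nz'(1)
      by (simp add: field_simps flip: power_mult_distrib)
    also have "\<dots> = (\<Sum>i\<le>n - k. h k i)"
      unfolding meixner_convolution[OF \<open>c \<noteq> 0\<close> nz'(2)] sum_distrib_left
    proof (rule sum.cong[OF refl])
      fix i assume "i \<in> {..n - k}"
      then have i: "i \<le> n - k" "k \<le> n - i" using k by auto
      have "pochhammer (x + \<beta>) (n - i) = pochhammer (x + \<beta>) k * pochhammer (x + \<beta> + of_nat k) (n - i - k)"
        using i(2) by (rule pochhammer_product)
      moreover have "T ^ (n - k) = T ^ i * T ^ (n - i - k)"
        using i k by (simp flip: power_add)
      moreover have "n - k - i = n - i - k" by simp
      ultimately show "pochhammer (\<beta> + x) k / fact k * (1 - T) ^ k * T ^ (n - k)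
          * (pochhammer (- x) i / fact i * (1 / c) ^ i
            * (pochhammer (x + (\<beta> + of_nat k)) (n - k - i) / fact (n - k - i))) = h k i"
        by (simp add: h_def add_ac mult_ac)
    qed
    finally show ?thesis .
  qed
  have collect: "(\<Sum>k\<le>n - i. h k i) = pochhammer (- x) i / fact i * (1 / (c / T)) ^ i
      * (pochhammer (x + \<beta>) (n - i) / fact (n - i))" (is "_ = ?C") for i
  proof -
    have "(\<Sum>k\<le>n - i. h k i)
        = (\<Sum>k\<le>n - i. ?C * (of_nat (n - i choose k) * (1 - T) ^ k * T ^ (n - i - k)))"
      by (rule sum.cong) (auto simp: h_def binomial_fact power_divide)
    also have "\<dots> = ?C * ((1 - T) + T) ^ (n - i)"
      unfolding binomial_ring sum_distrib_left ..
    finally show ?thesis by simp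
  qed
  have nz'': "c / T \<noteq> 0" using assms by simp
  have "pochhammer \<beta> n / fact n * (\<Sum>k\<le>n. ?R k) = (\<Sum>k\<le>n. \<Sum>i\<le>n - k. h k i)"
    unfolding sum_distrib_left by (intro sum.cong refl term_expand) simp
  also have "\<dots> = (\<Sum>i\<le>n. \<Sum>k\<le>n - i. h k i)"
  proof -
    have "{..n - k} = {i \<in> {..n}. k + i \<le> n}" if "k \<le> n" for k
      using that by auto
    moreover have "{..n - i} = {k \<in> {..n}. k + i \<le> n}" if "i \<le> n" for i
      using that by auto
    ultimately show ?thesis
      using sum.swap_restrict[of "{..n}" "{..n}" h "\<lambda>k i. k + i \<le> n"] by simp
  qed
  also have "\<dots> = pochhammer \<beta> n / fact n * meixner n x \<beta> (c / T)"
    unfolding collect meixner_convolution[OF nz'' nz] ..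
  finally show ?thesis
    using nz by simp
qed

theorem mainTheorem16:
  fixes \<beta> c t :: real and n :: nat and x :: "'a::real_normed_field"
  assumes "\<beta> > 0" and "0 < c" and "c < 1" and "t > ln c"
  shows "meixner n x (of_real \<beta>) (of_real (c * exp (- t))) =
    (\<Sum>k=0..n. pochhammer (- of_nat n) k * pochhammer (of_real \<beta> + x) k
        / (fact k * pochhammer (of_real \<beta>) k)
      * meixner (n - k) x (of_real \<beta> + of_nat k) (of_real c)
      * of_real (exp (real n * t)) * of_real ((1 - exp (- t)) ^ k))"
proof -
  have "pochhammer (of_real \<beta> :: 'a) n \<noteq> 0"
    using pochhammer_pos[OF \<open>\<beta> > 0\<close>, of n] by (simp add: pochhammer_of_real)
  then have "meixner n x (of_real \<beta>) (of_real c / of_real (exp t)) =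
      (\<Sum>k\<le>n. pochhammer (- of_nat n) k * pochhammer (of_real \<beta> + x) k
        / (fact k * pochhammer (of_real \<beta>) k) * meixner (n - k) x (of_real \<beta> + of_nat k) (of_real c)
        * of_real (exp t) ^ n * (1 - 1 / of_real (exp t)) ^ k)"
    using \<open>0 < c\<close> by (intro meixner_scale) auto
  then show ?thesis
    by (simp add: atLeast0AtMost exp_of_nat_mult exp_minus divide_inverse)
qed

end
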